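(* Let $(G,b,m)$, $G=(V_G,\vec E_G)$, be a finite connected weighted directed graph satisfying the standing assumptions in the context, let $H=(V_H,\vec E_H)$ be a subgraph of $G$ with $\#V_H=r$, and suppose that $G$ is $H$-flower-like. Then for every $1\le k\le r$, $$\lambda_k(S_H)\ \ge\ \lambda_k(S_G).$$
   Context: Setting. $G=(V,\vec E)$ is a directed graph with $V$ a finite nonempty set and $\vec E\subset V\times V$; $b:V\times V\to[0,\infty)$ satisfies $b(x,x)=0$ for all $x$ and $b(x,y)>0$ iff $(x,y)\in\vec E$; $m:V\to(0,\infty)$. Put $V_x^+=\{y:(x,y)\in\vec E\}$, $V_x^-=\{y:(y,x)\in\vec E\}$, $V_x=V_x^+\cup V_x^-$. Standing assumptions on $G$: (i) connected: any two distinct vertices are joined by a directed path from one of them to the other; (ii) $V_x^+\ne\emptyset$ and $V_x^-\neq\emptyset$ for all $x$; (iii) Assumption $(\beta)$: $\sum_{y\in V_x^+}b(x,y)=\sum_{y\in V_x^-}b(y,x)$ for all $x\in V$. Functions $f:V\to\mathbb C$ carry the inner product $(f,g)_m=\sum_{x}m(x)f(x)\overline{g(x)}$. With $a(x,y)=b(x,y)+b(y,x)$, the special Laplacian is the self-adjoint operator $S_Gf(x)=\frac1{m(x)}\sum_{y\in V_x}a(x,y)(f(x)-f(y))$. A subgraph $H=(V_H,\vec E_H)$ of $G$ is an induced one: $V_H\subset V_G$ and $\vec E_H=(V_H\times V_H)\cap\vec E_G$. It carries the restricted weights $b,m$, and $S_H$ acts on functions on $V_H$ by $S_Hf(x)=\frac1{m(x)}\sum_{y\in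 V_x\cap V_H}a(x,y)(f(x)-f(y))$. Eigenvalues are listed in nondecreasing order with multiplicity: $\lambda_1\le\lambda_2\le\cdots$. The interior of a vertex set $\Omega\subset V$ is $\overset{\circ}{\Omega}=\{y\in\Omega: V_y\subset\Omega\}$ (neighbors taken in $G$); for a subgraph $K$, $V_{\overset{\circ}{K}}$ denotes the interior of $V_K$. $G$ is called $H$-flower-like with respect to the subgraph $H$ if there is a family $(H_i)_{i\in I}$ of subgraphs of $G$ such that: (1) $V_G=V_H\cup\big(\biguplus_i V_{\overset{\circ}{H_i}}\big)$ (the interiors being pairwise disjoint); (2) for all $i\ne j$ in $I$, $x\in V_{\overset{\circ}{H_i}}$ and $y\in V_{\overset{\circ}{H_j}}$ imply $x\notin V_y$; (3) for every $i\in I$ there is $x_i\in V_G$ with $V_H\cap V_{H_i}=\{x_i\}$. *)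

theory Defs
  imports Complex_Main "HOL-Library.Function_Algebras" "HOL-Library.Disjoint_Sets"
    "Graph_Theory.Pair_Digraph" "Graph_Theory.Digraph_Component"
begin

definition out_nbrs :: "'a pair_pre_digraph \<Rightarrow> 'a \<Rightarrow> 'a set" where
  "out_nbrs G x = {y. (x, y) \<in> parcs G}"

definition in_nbrs :: "'a pair_pre_digraph \<Rightarrow> 'a \<Rightarrow> 'a set" where
  "in_nbrs G x = {y. (y, x) \<in> parcs G}"

definition nbrs :: "'a pair_pre_digraph \<Rightarrow> 'a \<Rightarrow> 'a set" where
  "nbrs G x = out_nbrs G x \<union> in_nbrs G x"

text \<open>
  The weights \<open>b\<close> and \<open>m\<close> are total functions on the vertex type; only their values on the
  vertex set matter. Connectedness asks for a directed path in at least one of the two directions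
  (it is neither \<^const>\<open>strongly_connected\<close> nor connectedness of the underlying undirected graph).
\<close>

locale balanced_weighted_digraph = pair_fin_digraph G
  for G :: "'a pair_pre_digraph" +
  fixes b :: "'a \<Rightarrow> 'a \<Rightarrow> real" and m :: "'a \<Rightarrow> real"
  assumes verts_nonempty: "pverts G \<noteq> {}"
    and b_nonneg: "\<And>x y. x \<in> pverts G \<Longrightarrow> y \<in> pverts G \<Longrightarrow> 0 \<le> b x y"
    and b_diag: "\<And>x. x \<in> pverts G \<Longrightarrow> b x x = 0"
    and b_pos_iff: "\<And>x y. x \<in> pverts G \<Longrightarrow> y \<in> pverts G \<Longrightarrow> 0 < b x y \<longleftrightarrow> (x, y) \<in> parcs G"
    and m_pos: "\<And>x. x \<in> pverts G \<Longrightarrow> 0 < m x"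
    and path_connected: "\<And>x y. x \<in> pverts G \<Longrightarrow> y \<in> pverts G \<Longrightarrow> x \<noteq> y \<Longrightarrow>
      reachable (with_proj G) x y \<or> reachable (with_proj G) y x"
    and out_nonempty: "\<And>x. x \<in> pverts G \<Longrightarrow> out_nbrs G x \<noteq> {}"
    and in_nonempty: "\<And>x. x \<in> pverts G \<Longrightarrow> in_nbrs G x \<noteq> {}"
    and balanced: "\<And>x. x \<in> pverts G \<Longrightarrow>
      (\<Sum>y\<in>out_nbrs G x. b x y) = (\<Sum>y\<in>in_nbrs G x. b y x)"

lemma nbrs_induced_subgraph:
  assumes "induced_subgraph (with_proj H) (with_proj G)" and "x \<in> pverts H"
  shows "nbrs H x = nbrs G x \<inter> pverts H"
  using assms
  by (auto simp: nbrs_def out_nbrs_def in_nbrs_def induced_subgraph_def subgraph_def)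

text \<open>
  The special Laplacian of a weighted digraph \<open>K\<close>. For an induced subgraph \<open>K\<close> of \<open>G\<close> the sum runs
  over the \<open>G\<close>-neighbours of \<open>x\<close> lying in \<open>K\<close>, by \<open>nbrs_induced_subgraph\<close>. Vertices outside a well-formed \<open>K\<close> have
  no neighbours in \<open>K\<close>, so the result vanishes off \<open>pverts K\<close>.
\<close>

definition special_laplacian ::
    "'a pair_pre_digraph \<Rightarrow> ('a \<Rightarrow> 'a \<Rightarrow> real) \<Rightarrow> ('a \<Rightarrow> real) \<Rightarrow> ('a \<Rightarrow> complex) \<Rightarrow> 'a \<Rightarrow> complex" where
  "special_laplacian K b m f x =
     1 / of_real (m x) * (\<Sum>y\<in>nbrs K x. of_real (b x y + b y x) * (f x - f y))"

text \<open>
  Functions on a vertex set \<open>U\<close> are represented by functions on the whole type vanishing off \<open>U\<close>.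
  They form a subspace of the complex vector space \<open>'a \<Rightarrow> complex\<close>.
\<close>

definition functions_on :: "'a set \<Rightarrow> ('a \<Rightarrow> complex) set" where
  "functions_on U = {f. \<forall>x. x \<notin> U \<longrightarrow> f x = 0}"

global_interpretation cfun: vector_space "\<lambda>(c::complex) (f::'a \<Rightarrow> complex) x. c * f x"
  defines cfun_dim = cfun.dim
  by unfold_locales (auto simp: fun_eq_iff algebra_simps)

definition eigenspace ::
    "'a set \<Rightarrow> (('a \<Rightarrow> complex) \<Rightarrow> 'a \<Rightarrow> complex) \<Rightarrow> complex \<Rightarrow> ('a \<Rightarrow> complex) set" where
  "eigenspace U S \<mu> = {f \<in> functions_on U. S f = (\<lambda>x. \<mu> * f x)}"

text \<open>
  All eigenvalues in nondecreasing order, each repeated according to the dimension of its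
  eigenspace. Ranging over complex \<open>\<mu>\<close> means that the list is determined only for operators whose
  eigenvalues are all real and finite in number, as for the self-adjoint operators considered here.
\<close>

definition eigenvalue_list ::
    "'a set \<Rightarrow> (('a \<Rightarrow> complex) \<Rightarrow> 'a \<Rightarrow> complex) \<Rightarrow> real list" where
  "eigenvalue_list U S =
     (THE ls. sorted ls \<and>
        (\<forall>\<mu>::complex. count_list (map complex_of_real ls) \<mu> = cfun_dim (eigenspace U S \<mu>)))"

text \<open>The eigenvalues are numbered from 1.\<close>

definition eigenvalue_nr ::
    "nat \<Rightarrow> 'a pair_pre_digraph \<Rightarrow> ('a \<Rightarrow> 'a \<Rightarrow> real) \<Rightarrow> ('a \<Rightarrow> real) \<Rightarrow> real" where
  "eigenvalue_nr k K b m = eigenvalue_list (pverts K) (special_laplacian K b m) ! (k - 1)"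

definition vertex_interior :: "'a pair_pre_digraph \<Rightarrow> 'a set \<Rightarrow> 'a set" where
  "vertex_interior G \<Omega> = {y \<in> \<Omega>. nbrs G y \<subseteq> \<Omega>}"

text \<open>
  HOL cannot quantify existentially over the type of the index set \<open>I\<close>, so it is a parameter;
  it is left as a type variable where the notion is used as a hypothesis.
\<close>

definition flower_like ::
    "'i itself \<Rightarrow> 'a pair_pre_digraph \<Rightarrow> 'a pair_pre_digraph \<Rightarrow> bool" where
  "flower_like TYPE('i) H G \<longleftrightarrow>
     (\<exists>(I :: 'i set) (K :: 'i \<Rightarrow> 'a pair_pre_digraph).
        (\<forall>i\<in>I. induced_subgraph (with_proj (K i)) (with_proj G)) \<and>
        disjoint_family_on (\<lambda>i. vertex_interior G (pverts (K i))) I \<and>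
        pverts G = pverts H \<union> (\<Union>i\<in>I. vertex_interior G (pverts (K i))) \<and>
        (\<forall>i\<in>I. \<forall>j\<in>I. i \<noteq> j \<longrightarrow>
           (\<forall>x\<in>vertex_interior G (pverts (K i)). \<forall>y\<in>vertex_interior G (pverts (K j)).
              x \<notin> nbrs G y)) \<and>
        (\<forall>i\<in>I. \<exists>v\<in>pverts G. pverts H \<inter> pverts (K i) = {v}))"

end

theory Submission
  imports Defs "HOL-Computational_Algebra.Fundamental_Theorem_Algebra"
begin

text \<open>
  Collapsing every petal onto the vertex it shares with \<open>H\<close> is a retraction \<open>\<phi>\<close> of the vertices of \<open>G\<close>
  onto those of \<open>H\<close>, and every edge of \<open>G\<close> either lies in \<open>H\<close> or is collapsed by \<open>\<phi>\<close>. Hence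
  \<open>f \<mapsto> f \<circ> \<phi>\<close> preserves the Dirichlet form and does not decrease the norm, and the min-max
  principle compares the eigenvalues. The spectral theorem behind the min-max principle comes from
  a maximal orthonormal set of eigenvectors: if its orthogonal complement were nonzero, it would be
  an invariant subspace and contain another eigenvector.
\<close>

section \<open>Linear algebra of complex-valued functions\<close>

abbreviation (input) fscale :: "complex \<Rightarrow> ('a \<Rightarrow> complex) \<Rightarrow> 'a \<Rightarrow> complex"
  where "fscale \<equiv> \<lambda>c f x. c * f x"

text \<open>Two vertex types are allowed, so that linear maps between functions on different vertex
  sets are covered.\<close>

interpretation cfun_pair: vector_space_pair
    "fscale :: complex \<Rightarrow> ('a \<Rightarrow> complex) \<Rightarrow> 'a \<Rightarrow> complex"
    "fscale :: complex \<Rightarrow> ('b \<Rightarrow> complex) \<Rightarrow> 'b \<Rightarrow> complex"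
  by unfold_locales

lemma cfun_linearI:
  assumes "\<And>f g. T (f + g) = T f + T g" "\<And>c f. T (fscale c f) = fscale c (T f)"
  shows "Vector_Spaces.linear fscale fscale T"
  using assms by unfold_locales

lemma sum_fun_apply: "(\<Sum>i\<in>A. h i) x = (\<Sum>i\<in>A. h i x)"
  for h :: "'i \<Rightarrow> 'a \<Rightarrow> 'b::comm_monoid_add"
  by (induction A rule: infinite_finite_induct) auto

lemma subspace_functions_on: "cfun.subspace (functions_on U)"
  by (auto simp: cfun.subspace_def functions_on_def)

text \<open>If \<open>g\<close> is injective on the indices, its image is too large to be
  independent; a repetition \<open>g i = g j\<close> is itself a relation, with coefficients 1 and
  -1. Indexing matters because the iterates of an operator at a vector may coincide.\<close>

lemma cfun_family_dependent:
  fixes g :: "nat \<Rightarrow> 'a \<Rightarrow> complex"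
  assumes "finite B" "\<And>i. g i \<in> cfun.span B"
  obtains c i where "i \<le> card B" "c i \<noteq> 0" "(\<Sum>j\<le>card B. fscale (c j) (g j)) = 0"
proof (cases "inj_on g {..card B}")
  case False
  then obtain i j where ij: "i \<le> card B" "j \<le> card B" "i \<noteq> j" "g i = g j"
    by (auto simp: inj_on_def)
  define c :: "nat \<Rightarrow> complex" where "c k = (if k = i then 1 else if k = j then -1 else 0)" for k
  have "(\<Sum>k\<le>card B. fscale (c k) (g k)) = (\<Sum>k\<in>{i, j}. fscale (c k) (g k))"
    using ij by (intro sum.mono_neutral_right) (auto simp: c_def fun_eq_iff)
  also have "\<dots> = 0"
    using ij by (auto simp: c_def fun_eq_iff)
  finally show thesis
    using that[of i c] ij by (simp add: c_def)
next
  case True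
  have "cfun.dependent (g ` {..card B})"
  proof (rule ccontr)
    assume "cfun.independent (g ` {..card B})"
    then have "card (g ` {..card B}) \<le> card B"
      using cfun.independent_span_bound[OF assms(1)] assms(2) by blast
    then show False
      using True by (simp add: card_image)
  qed
  then obtain u where u: "\<exists>v\<in>g ` {..card B}. u v \<noteq> 0" "(\<Sum>v\<in>g ` {..card B}. fscale (u v) v) = 0"
    by (subst (asm) cfun.dependent_finite) auto
  have "(\<Sum>j\<le>card B. fscale (u (g j)) (g j)) = 0"
    using u(2) True by (simp add: sum.reindex)
  with u(1) that[of _ "u \<circ> g"] show thesis
    by auto
qed

text \<open>If \<open>T\<close> were injective on the span of \<open>A\<close>, the image of
  \<open>A\<close> would be an independent set of \<open>card A\<close> elements in a space spanned
  by fewer. This is the dimension count of the min-max argument.\<close>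

lemma cfun_linear_kernel:
  fixes T :: "('a \<Rightarrow> complex) \<Rightarrow> 'b \<Rightarrow> complex"
  assumes "Vector_Spaces.linear fscale fscale T" "cfun.independent A" "finite C"
    and "card C < card A" "\<And>f. T f \<in> cfun.span C"
  obtains f where "f \<in> cfun.span A" "f \<noteq> 0" "T f = 0"
proof -
  have "\<not> inj_on T (cfun.span A)"
  proof
    assume inj: "inj_on T (cfun.span A)"
    then have "cfun.independent (T ` A)"
      using assms by (intro cfun_pair.linear_independent_injective_image)
    then have "card (T ` A) \<le> card C"
      using cfun.independent_span_bound[OF assms(3)] assms(5) by blast
    moreover have "card (T ` A) = card A"
      using inj cfun.span_superset by (metis card_image inj_on_subset)
    ultimately show False
      using assms(4) by simp
  qed
  then show thesis
    using that cfun_pair.linear_inj_on_iff_eq_0[OF assms(1) cfun.subspace_span] by blast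
qed

section \<open>Multiplicities and positions in sorted lists\<close>

lemma count_list_of_real:
  "count_list (map complex_of_real ls) \<mu> =
     (if \<mu> = of_real (Re \<mu>) then count (mset ls) (Re \<mu>) else 0)"
  by (induction ls) (auto simp: complex_eq_iff)

text \<open>By monotonicity an entry below \<open>ls ! i\<close> stands before position
  \<open>i\<close>. Positions start from 0, so at most \<open>i\<close> entries are smaller, while
  more than \<open>i\<close> entries are \<le> \<open>ls ! i\<close> by the next lemma; this gap
  makes the later dimension count strict.\<close>

lemma sorted_filter_less_nth:
  fixes ls :: "'a::linorder list"
  assumes "sorted ls" "i < length ls"
  shows "length (filter (\<lambda>x. x < ls ! i) ls) \<le> i"
proof -
  have "{j. j < length ls \<and> ls ! j < ls ! i} \<subseteq> {..<i}"
    using sorted_nth_mono[OF assms(1), of i] by (force simp: not_less[symmetric])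
  from card_mono[OF _ this] show ?thesis
    by (simp add: length_filter_conv_card)
qed

lemma sorted_filter_le_nth:
  fixes ls :: "'a::linorder list"
  assumes "sorted ls" "i < length ls"
  shows "i < length (filter (\<lambda>x. x \<le> ls ! i) ls)"
proof -
  have "{..i} \<subseteq> {j. j < length ls \<and> ls ! j \<le> ls ! i}"
    using assms by (auto intro: sorted_nth_mono)
  from card_mono[OF _ this] show ?thesis
    by (simp add: length_filter_conv_card)
qed

section \<open>The weighted inner product and orthonormal sets\<close>

locale weighted_vertex_set =
  fixes U :: "'a set" and m :: "'a \<Rightarrow> real"
  assumes finite_U: "finite U" and m_pos: "\<And>x. x \<in> U \<Longrightarrow> 0 < m x"
begin

text \<open>Values off \<open>U\<close> are ignored, so positive definiteness is claimed on
  \<open>functions_on U\<close> only.\<close>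

definition ip :: "('a \<Rightarrow> complex) \<Rightarrow> ('a \<Rightarrow> complex) \<Rightarrow> complex" where
  "ip f g = (\<Sum>x\<in>U. of_real (m x) * f x * cnj (g x))"

lemma ip_add_left: "ip (f + g) h = ip f h + ip g h"
  by (simp add: ip_def algebra_simps sum.distrib)

lemma ip_diff_left: "ip (f - g) h = ip f h - ip g h"
  by (simp add: ip_def algebra_simps sum_subtractf)

lemma ip_scale_left: "ip (fscale c f) h = c * ip f h"
  by (simp add: ip_def algebra_simps sum_distrib_left)

lemma ip_scale_right: "ip f (fscale c h) = cnj c * ip f h"
  by (simp add: ip_def algebra_simps sum_distrib_left)

lemma ip_zero_left [simp]: "ip 0 h = 0"
  by (simp add: ip_def)

lemma ip_sum_left: "ip (\<Sum>i\<in>A. f i) h = (\<Sum>i\<in>A. ip (f i) h)"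
  by (induction A rule: infinite_finite_induct)
    (simp_all only: sum.infinite sum.empty sum.insert ip_zero_left ip_add_left simp_thms)

lemma ip_commute: "ip g f = cnj (ip f g)"
  by (simp add: ip_def algebra_simps)

lemma ip_self: "ip f f = of_real (\<Sum>x\<in>U. m x * (cmod (f x))\<^sup>2)"
  unfolding ip_def of_real_sum
  by (intro sum.cong refl) (simp add: mult.assoc flip: complex_norm_square)

lemma ip_self_pos:
  assumes "f \<in> functions_on U" "f \<noteq> 0"
  shows "0 < Re (ip f f)"
proof -
  obtain x where "x \<in> U" "f x \<noteq> 0"
    using assms by (auto simp: functions_on_def fun_eq_iff)
  then show ?thesis
    unfolding ip_self Re_complex_of_real using finite_U m_pos
    by (intro sum_pos2[of U x]) (auto simp: less_imp_le)
qed

text \<open>Membership in \<open>functions_on U\<close> is included because \<open>ip\<close> does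
  not see values off \<open>U\<close>. Finiteness is a consequence, by
  \<open>orthonormal_card\<close>.\<close>

definition orthonormal :: "('a \<Rightarrow> complex) set \<Rightarrow> bool" where
  "orthonormal B \<longleftrightarrow> B \<subseteq> functions_on U \<and> (\<forall>e\<in>B. \<forall>e'\<in>B. ip e e' = (if e = e' then 1 else 0))"

lemma orthonormal_subset: "orthonormal B \<Longrightarrow> A \<subseteq> B \<Longrightarrow> orthonormal A"
  unfolding orthonormal_def by blast

lemma ip_orthonormal_sum:
  assumes "orthonormal B" "finite A" "A \<subseteq> B" "e \<in> B"
  shows "ip (\<Sum>e\<in>A. fscale (c e) e) e = (if e \<in> A then c e else 0)"
proof -
  have "ip (\<Sum>e\<in>A. fscale (c e) e) e = (\<Sum>e'\<in>A. if e' = e then c e' else 0)"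
    unfolding ip_sum_left ip_scale_left
    using assms by (intro sum.cong) (auto simp: orthonormal_def)
  with assms(2) show ?thesis
    by simp
qed

lemma orthonormal_independent:
  assumes "orthonormal B"
  shows "cfun.independent B"
  unfolding cfun.independent_explicit_finite_subsets
proof (intro allI impI ballI)
  fix A u v
  assume A: "A \<subseteq> B" "finite A" "(\<Sum>v\<in>A. fscale (u v) v) = 0" "v \<in> A"
  then have "u v = ip (\<Sum>v\<in>A. fscale (u v) v) v"
    by (subst ip_orthonormal_sum[OF assms]) auto
  with A(3) show "u v = 0"
    by simp
qed

text \<open>The indicator functions of the vertices are orthogonal with squared norm
  \<open>m x\<close>; dividing by \<open>sqrt (m x)\<close> normalizes them. This fixes the
  dimension of \<open>functions_on U\<close> as \<open>card U\<close>.\<close>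

lemma obtain_orthonormal_basis:
  obtains D where "orthonormal D" "finite D" "card D = card U" "cfun.span D = functions_on U"
proof -
  define d :: "'a \<Rightarrow> 'a \<Rightarrow> complex"
    where "d x = (\<lambda>y. if y = x then of_real (1 / sqrt (m x)) else 0)" for x
  have inj: "inj_on d U"
    using m_pos by (force simp: inj_on_def d_def fun_eq_iff)
  have "ip (d x) (d y) = (if x = y then 1 else 0)" if "x \<in> U" "y \<in> U" for x y
  proof -
    have "ip (d x) (d y) = (\<Sum>z\<in>U. if z = x then (if x = y then 1 else 0) else 0)"
      unfolding ip_def
    proof (intro sum.cong refl)
      fix z assume "z \<in> U"
      have "complex_of_real (m x) / (complex_of_real (sqrt (m x)) * complex_of_real (sqrt (m x))) = 1"
        using m_pos[OF \<open>x \<in> U\<close>] by (simp flip: of_real_mult)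
      then show "of_real (m z) * d x z * cnj (d y z) = (if z = x then (if x = y then 1 else 0) else 0)"
        by (auto simp: d_def)
    qed
    with that finite_U show ?thesis
      by simp
  qed
  then have on: "orthonormal (d ` U)"
    using inj by (auto simp: orthonormal_def functions_on_def inj_on_eq_iff) (auto simp: d_def)
  have "functions_on U \<subseteq> cfun.span (d ` U)"
  proof
    fix f assume f: "f \<in> functions_on U"
    \<comment> \<open>The factor \<open>sqrt (m x)\<close> undoes the normalization of
      \<open>d x\<close>.\<close>
    have "f = (\<Sum>x\<in>U. fscale (f x * of_real (sqrt (m x))) (d x))"
    proof
      fix y
      have "(\<Sum>x\<in>U. f x * of_real (sqrt (m x)) * d x y) = (\<Sum>x\<in>U. if x = y then f y else 0)"
        by (intro sum.cong refl) (use m_pos in \<open>force simp: d_def\<close>)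
      also have "\<dots> = f y"
        using f finite_U by (auto simp: functions_on_def)
      finally show "f y = (\<Sum>x\<in>U. fscale (f x * of_real (sqrt (m x))) (d x)) y"
        by (simp add: sum_fun_apply)
    qed
    also have "\<dots> \<in> cfun.span (d ` U)"
      by (intro cfun.span_sum cfun.span_scale cfun.span_base imageI)
    finally show "f \<in> cfun.span (d ` U)" .
  qed
  moreover have "cfun.span (d ` U) \<subseteq> functions_on U"
    using on by (intro cfun.span_minimal subspace_functions_on) (simp add: orthonormal_def)
  ultimately show thesis
    using that[OF on] finite_U card_image[OF inj] by auto
qed

text \<open>An orthonormal set is independent and lies in a space spanned by \<open>card U\<close>
  vectors.\<close>

lemma orthonormal_card:
  assumes "orthonormal B"
  shows "finite B" "card B \<le> card U"
proof -
  obtain D where "finite D" "card D = card U" "cfun.span D = functions_on U"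
    by (rule obtain_orthonormal_basis)
  then show "finite B" "card B \<le> card U"
    using cfun.independent_span_bound[OF \<open>finite D\<close> orthonormal_independent[OF assms]] assms
    by (auto simp: orthonormal_def)
qed

lemma orthonormal_basis_card:
  assumes "orthonormal B" "cfun.span B = functions_on U"
  shows "card B = card U"
proof -
  obtain D where D: "orthonormal D" "finite D" "card D = card U" "cfun.span D = functions_on U"
    by (rule obtain_orthonormal_basis)
  then have "card D \<le> card B"
    using cfun.independent_span_bound[OF orthonormal_card(1)[OF assms(1)]
        orthonormal_independent[OF D(1)]]
      assms(2) by (auto simp: orthonormal_def)
  with D(3) orthonormal_card(2)[OF assms(1)] show ?thesis
    by simp
qed

lemma ip_span_eq_0:
  assumes "orthonormal B" "A \<subseteq> B" "f \<in> cfun.span A" "e \<in> B - A"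
  shows "ip f e = 0"
proof -
  have "finite A"
    using orthonormal_card(1)[OF assms(1)] assms(2) finite_subset by blast
  then obtain c where "f = (\<Sum>e\<in>A. fscale (c e) e)"
    using assms(3) cfun.span_finite[of A] by auto
  then show ?thesis
    using ip_orthonormal_sum[OF assms(1) \<open>finite A\<close> assms(2)] assms(4) by auto
qed

lemma orthonormal_expansion:
  assumes "orthonormal B" "f \<in> cfun.span B"
  shows "f = (\<Sum>e\<in>B. fscale (ip f e) e)"
proof -
  obtain c where c: "f = (\<Sum>e\<in>B. fscale (c e) e)"
    using assms(2) cfun.span_finite[OF orthonormal_card(1)[OF assms(1)]] by auto
  have "ip f e = c e" if "e \<in> B" for e
    unfolding c using that
    by (subst ip_orthonormal_sum[OF assms(1)]) (auto simp: orthonormal_card(1)[OF assms(1)])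
  then have "(\<Sum>e\<in>B. fscale (ip f e) e) = (\<Sum>e\<in>B. fscale (c e) e)"
    by (intro sum.cong) auto
  with c show ?thesis
    by simp
qed

lemma parseval:
  assumes "orthonormal B" "f \<in> cfun.span B"
  shows "Re (ip f f) = (\<Sum>e\<in>B. (cmod (ip f e))\<^sup>2)"
proof -
  \<comment> \<open>Only the first argument is expanded; conjugate symmetry of \<open>ip\<close>
    then pairs each coefficient with its conjugate.\<close>
  have "ip f f = ip (\<Sum>e\<in>B. fscale (ip f e) e) f"
    using orthonormal_expansion[OF assms] by simp
  also have "\<dots> = (\<Sum>e\<in>B. ip f e * cnj (ip f e))"
    by (simp add: ip_sum_left ip_scale_left flip: ip_commute)
  also have "\<dots> = of_real (\<Sum>e\<in>B. (cmod (ip f e))\<^sup>2)"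
    by (simp flip: complex_norm_square)
  finally show ?thesis
    by simp
qed

end

section \<open>The spectral theorem for symmetric operators\<close>

locale symmetric_operator = weighted_vertex_set +
  fixes S :: "('a \<Rightarrow> complex) \<Rightarrow> 'a \<Rightarrow> complex"
  assumes linear_S: "Vector_Spaces.linear fscale fscale S"
    and S_functions_on: "f \<in> functions_on U \<Longrightarrow> S f \<in> functions_on U"
    and ip_S: "f \<in> functions_on U \<Longrightarrow> g \<in> functions_on U \<Longrightarrow> ip (S f) g = ip f (S g)"
begin

text \<open>Moving \<open>S\<close> from one argument of \<open>ip\<close> to the other replaces
  \<open>\<mu>\<close> by its conjugate, and \<open>ip f f\<close> is nonzero.\<close>

lemma eigenvalue_real:
  assumes "f \<in> functions_on U" "f \<noteq> 0" "S f = fscale \<mu> f"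
  shows "\<mu> = of_real (Re \<mu>)"
proof -
  have "\<mu> * ip f f = cnj \<mu> * ip f f"
    using ip_S[OF assms(1,1)] by (simp add: assms(3) ip_scale_left ip_scale_right)
  moreover have "ip f f \<noteq> 0"
    using ip_self_pos[OF assms(1,2)] by auto
  ultimately have "cnj \<mu> = \<mu>"
    by simp
  then show ?thesis
    by (simp add: complex_eq_iff)
qed

text \<open>The polynomial \<open>p\<close> evaluated at the operator \<open>S\<close> and applied
  to \<open>v\<close>.\<close>

definition poly_act :: "complex poly \<Rightarrow> ('a \<Rightarrow> complex) \<Rightarrow> 'a \<Rightarrow> complex" where
  "poly_act p v = (\<Sum>i\<le>degree p. fscale (coeff p i) ((S ^^ i) v))"

text \<open>Coefficients beyond the degree vanish; this lets polynomials of different degrees be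
  summed over one range of indices.\<close>

lemma poly_act_eq:
  assumes "degree p \<le> n"
  shows "poly_act p v = (\<Sum>i\<le>n. fscale (coeff p i) ((S ^^ i) v))"
  unfolding poly_act_def using assms
  by (intro sum.mono_neutral_left) (auto simp: fun_eq_iff coeff_eq_0)

lemma poly_act_add: "poly_act (p + q) v = poly_act p v + poly_act q v"
proof
  fix x
  define n where "n = max (degree p) (degree q)"
  have p: "poly_act p v = (\<Sum>i\<le>n. fscale (coeff p i) ((S ^^ i) v))"
    by (rule poly_act_eq) (simp add: n_def)
  have q: "poly_act q v = (\<Sum>i\<le>n. fscale (coeff q i) ((S ^^ i) v))"
    by (rule poly_act_eq) (simp add: n_def)
  have pq: "poly_act (p + q) v = (\<Sum>i\<le>n. fscale (coeff (p + q) i) ((S ^^ i) v))"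
    by (rule poly_act_eq) (simp add: n_def degree_add_le_max)
  show "poly_act (p + q) v x = (poly_act p v + poly_act q v) x"
    unfolding p q pq plus_fun_apply sum_fun_apply coeff_add distrib_right sum.distrib ..
qed

lemma poly_act_smult: "poly_act (smult c p) v = fscale c (poly_act p v)"
proof
  fix x
  have "poly_act (smult c p) v = (\<Sum>i\<le>degree p. fscale (coeff (smult c p) i) ((S ^^ i) v))"
    by (intro poly_act_eq degree_smult_le)
  then show "poly_act (smult c p) v x = c * poly_act p v x"
    by (simp only: poly_act_def sum_fun_apply sum_distrib_left mult.assoc coeff_smult)
qed

text \<open>Multiplying a polynomial by the variable corresponds to one more application of
  \<open>S\<close>.\<close>

lemma poly_act_shift: "poly_act (pCons 0 p) v = S (poly_act p v)"
proof -
  have "poly_act (pCons 0 p) v = (\<Sum>i\<le>Suc (degree p). fscale (coeff (pCons 0 p) i) ((S ^^ i) v))"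
    by (rule poly_act_eq) (simp add: degree_pCons_le)
  also have "\<dots> = (\<Sum>i\<le>degree p. fscale (coeff p i) (S ((S ^^ i) v)))"
    by (subst sum.atMost_Suc_shift) (simp add: fun_eq_iff)
  also have "\<dots> = S (poly_act p v)"
    by (simp add: poly_act_def cfun_pair.linear_sum[OF linear_S] cfun_pair.linear_scale[OF linear_S])
  finally show ?thesis .
qed

lemma poly_act_invariant:
  assumes "cfun.subspace W" "\<And>w. w \<in> W \<Longrightarrow> S w \<in> W" "v \<in> W"
  shows "poly_act p v \<in> W"
proof -
  have "(S ^^ i) v \<in> W" for i
    using assms by (induction i) auto
  then show ?thesis
    unfolding poly_act_def using assms(1)
    by (intro cfun.subspace_sum cfun.subspace_scale) auto
qed

text \<open>Splitting off a root, \<open>p = [:-\<mu>, 1:] * q\<close>, shows that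
  \<open>S - \<mu>\<close> annihilates \<open>poly_act q v\<close>. Either this vector is nonzero,
  hence an eigenvector in the invariant subspace \<open>W\<close>, or \<open>q\<close> is an
  annihilating polynomial of smaller degree. A nonzero constant cannot annihilate \<open>v\<close>,
  so the descent stops.\<close>

lemma eigenvector_of_annihilating_poly:
  assumes "cfun.subspace W" "\<And>w. w \<in> W \<Longrightarrow> S w \<in> W" "v \<in> W" "v \<noteq> 0"
    and "p \<noteq> 0" "poly_act p v = 0"
  shows "\<exists>w \<mu>. w \<in> W \<and> w \<noteq> 0 \<and> S w = fscale \<mu> w"
  using assms(5,6)
proof (induction "degree p" arbitrary: p rule: less_induct)
  case less
  show ?case
  proof (cases "degree p = 0")
    case True
    then obtain a where "p = [:a:]"
      by (metis degree_eq_zeroE)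
    with less.prems assms(4) show ?thesis
      by (auto simp: poly_act_def fun_eq_iff)
  next
    case False
    then obtain \<mu> where "poly p \<mu> = 0"
      using fundamental_theorem_of_algebra_alt[of p] by (metis degree_pCons_0)
    then obtain q where q: "p = [:-\<mu>, 1:] * q"
      by (auto simp: poly_eq_0_iff_dvd)
    with less.prems(1) have "q \<noteq> 0"
      by auto
    have "0 = S (poly_act q v) - fscale \<mu> (poly_act q v)"
    proof -
      have "p = pCons 0 q + smult (-\<mu>) q"
        by (simp add: q)
      then have "poly_act p v = S (poly_act q v) + fscale (-\<mu>) (poly_act q v)"
        by (simp only: poly_act_add poly_act_shift poly_act_smult)
      with less.prems(2) show ?thesis
        by (simp add: fun_eq_iff)
    qed
    then have S: "S (poly_act q v) = fscale \<mu> (poly_act q v)"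
      by simp
    show ?thesis
    proof (cases "poly_act q v = 0")
      case True
      have "degree q < degree p"
        unfolding q using \<open>q \<noteq> 0\<close> by (subst degree_mult_eq) auto
      with less.hyps[of q] True \<open>q \<noteq> 0\<close> show ?thesis
        by blast
    next
      case False
      with S poly_act_invariant[OF assms(1-3)] show ?thesis
        by blast
    qed
  qed
qed

text \<open>The iterates of \<open>v\<close> up to the exponent \<open>card D\<close> are one more
  than the dimension allows, hence dependent; the relation, read as a polynomial in
  \<open>S\<close>, annihilates \<open>v\<close>.\<close>

lemma eigenvector_exists:
  assumes "cfun.subspace W" "\<And>w. w \<in> W \<Longrightarrow> S w \<in> W" "W \<subseteq> functions_on U" "v \<in> W" "v \<noteq> 0"
  shows "\<exists>w \<mu>. w \<in> W \<and> w \<noteq> 0 \<and> S w = fscale \<mu> w"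
proof -
  obtain D where D: "finite D" "cfun.span D = functions_on U"
    by (rule obtain_orthonormal_basis)
  have in_span: "(S ^^ i) v \<in> cfun.span D" for i
    using assms by (induction i) (auto simp: D(2) S_functions_on)
  obtain c i where c: "i \<le> card D" "c i \<noteq> 0" "(\<Sum>j\<le>card D. fscale (c j) ((S ^^ j) v)) = 0"
    by (rule cfun_family_dependent[OF D(1) in_span])
  \<comment> \<open>Only the coefficients up to \<open>card D\<close> belong to the relation;
    \<open>c i \<noteq> 0\<close> makes \<open>p\<close> nonzero.\<close>
  define p where "p = (\<Sum>j\<le>card D. monom (c j) j)"
  have coeff_p: "coeff p j = (if j \<le> card D then c j else 0)" for j
    by (simp add: p_def coeff_sum)
  have "degree p \<le> card D"
    by (intro degree_le) (auto simp: coeff_p)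
  then have "poly_act p v = 0"
    using c(3) by (simp add: poly_act_eq coeff_p)
  moreover have "p \<noteq> 0"
    using c coeff_p[of i] by auto
  ultimately show ?thesis
    using eigenvector_of_annihilating_poly[OF assms(1,2,4,5)] by blast
qed

definition eigenbasis :: "('a \<Rightarrow> complex) set \<Rightarrow> (('a \<Rightarrow> complex) \<Rightarrow> real) \<Rightarrow> bool" where
  "eigenbasis B l \<longleftrightarrow> orthonormal B \<and> cfun.span B = functions_on U \<and>
     (\<forall>e\<in>B. S e = fscale (of_real (l e)) e)"

lemma obtain_eigenbasis:
  obtains B l where "eigenbasis B l"
proof -
  define P where "P B \<longleftrightarrow> orthonormal B \<and> (\<forall>e\<in>B. \<exists>\<mu>. S e = fscale \<mu> e)" for B
  have "P {}"
    by (simp add: P_def orthonormal_def)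
  moreover have "\<And>B. P B \<Longrightarrow> card B < Suc (card U)"
    using orthonormal_card(2) by (auto simp: P_def less_Suc_eq_le)
  \<comment> \<open>The bound \<open>card U\<close> on the size of orthonormal sets provides one of
    largest cardinality.\<close>
  ultimately obtain B where B: "P B" and max: "\<And>B'. P B' \<Longrightarrow> card B' \<le> card B"
    using ex_has_greatest_nat[of P "{}" card "Suc (card U)"] by (auto simp: less_imp_le)
  have on: "orthonormal B" and fin: "finite B"
    using B orthonormal_card(1) by (auto simp: P_def)
  define W where "W = {f \<in> functions_on U. \<forall>e\<in>B. ip f e = 0}"
  have W_sub: "cfun.subspace W"
    using subspace_functions_on[of U]
    by (auto simp: W_def cfun.subspace_def ip_add_left ip_scale_left)
  \<comment> \<open>\<open>W\<close> is the orthogonal complement of \<open>B\<close>. Symmetry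
    moves \<open>S\<close> onto a vector of \<open>B\<close>, where it acts as a scalar.\<close>
  have W_inv: "S f \<in> W" if "f \<in> W" for f
  proof -
    have "ip (S f) e = 0" if "e \<in> B" for e
    proof -
      obtain \<mu> where "S e = fscale \<mu> e"
        using B \<open>e \<in> B\<close> by (auto simp: P_def)
      with \<open>f \<in> W\<close> \<open>e \<in> B\<close> on show ?thesis
        by (subst ip_S) (auto simp: W_def ip_scale_right orthonormal_def)
    qed
    with that show ?thesis
      by (auto simp: W_def S_functions_on)
  qed
  have W_zero: "f = 0" if "f \<in> W" for f
  proof (rule ccontr)
    assume "f \<noteq> 0"
    then obtain w \<mu> where w: "w \<in> W" "w \<noteq> 0" "S w = fscale \<mu> w"
      using eigenvector_exists[OF W_sub W_inv _ \<open>f \<in> W\<close>] by (auto simp: W_def)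
    \<comment> \<open>The eigenvector \<open>w\<close> is scaled to unit length, so that adding it
      to \<open>B\<close> contradicts maximality.\<close>
    define N where "N = Re (ip w w)"
    have N: "N > 0" "ip w w = of_real N"
      using w ip_self_pos by (auto simp: W_def N_def ip_self)
    define e where "e = fscale (of_real (1 / sqrt N)) w"
    have "e \<in> W"
      unfolding e_def using W_sub w(1) by (rule cfun.subspace_scale)
    have "ip e e = of_real (1 / sqrt N * (1 / sqrt N) * N)"
      unfolding e_def ip_scale_left ip_scale_right N(2)
      by (simp only: complex_cnj_complex_of_real of_real_mult mult_ac)
    also have "1 / sqrt N * (1 / sqrt N) * N = 1"
      using N(1) by (simp add: field_simps)
    finally have "ip e e = 1"
      by simp
    have "e \<notin> B"
      using \<open>e \<in> W\<close> \<open>ip e e = 1\<close> by (auto simp: W_def)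
    have "S e = fscale \<mu> e"
      unfolding e_def cfun_pair.linear_scale[OF linear_S] w(3) by (simp add: fun_eq_iff)
    moreover have "ip e' e = 0" if "e' \<in> B" for e'
      using that \<open>e \<in> W\<close> ip_commute[of e' e] by (simp add: W_def)
    ultimately have "P (insert e B)"
      using B \<open>e \<in> W\<close> \<open>ip e e = 1\<close> \<open>e \<notin> B\<close> by (auto simp: P_def orthonormal_def W_def)
    from max[OF this] show False
      using fin \<open>e \<notin> B\<close> by simp
  qed
  have "functions_on U \<subseteq> cfun.span B"
  proof
    fix f assume f: "f \<in> functions_on U"
    \<comment> \<open>The orthogonal projection of \<open>f\<close> onto the span of
      \<open>B\<close>; the remainder \<open>f - g\<close> lies in \<open>W\<close> and is therefore
      zero.\<close>
    define g where "g = (\<Sum>e\<in>B. fscale (ip f e) e)"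
    have g: "g \<in> cfun.span B"
      unfolding g_def by (intro cfun.span_sum cfun.span_scale cfun.span_base)
    have "ip g e = ip f e" if "e \<in> B" for e
      unfolding g_def using that fin by (subst ip_orthonormal_sum[OF on]) auto
    moreover have "g \<in> functions_on U"
      using g cfun.span_minimal[OF _ subspace_functions_on, of B U] on by (auto simp: orthonormal_def)
    ultimately have "f - g \<in> W"
      using f cfun.subspace_diff[OF subspace_functions_on] by (auto simp: W_def ip_diff_left)
    then show "f \<in> cfun.span B"
      using W_zero g by force
  qed
  moreover have "cfun.span B \<subseteq> functions_on U"
    using on by (intro cfun.span_minimal subspace_functions_on) (simp add: orthonormal_def)
  moreover have "\<exists>l. \<forall>e\<in>B. S e = fscale (complex_of_real (l e)) e"
  proof (intro bchoice ballI)
    fix e assume "e \<in> B"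
    then obtain \<mu> where \<mu>: "S e = fscale \<mu> e"
      using B by (auto simp: P_def)
    have "e \<in> functions_on U" "e \<noteq> 0"
      using on \<open>e \<in> B\<close> by (force simp: orthonormal_def)+
    from eigenvalue_real[OF this \<mu>] \<mu> show "\<exists>y. S e = fscale (complex_of_real y) e"
      by metis
  qed
  ultimately show thesis
    using that on by (auto simp: eigenbasis_def)
qed

section \<open>Eigenspaces and the eigenvalue list\<close>

lemma ip_S_eigenbasis:
  assumes "eigenbasis B l" "f \<in> functions_on U" "e \<in> B"
  shows "ip (S f) e = l e * ip f e"
  using assms by (subst ip_S) (auto simp: eigenbasis_def orthonormal_def ip_scale_right)

text \<open>For an eigenvector \<open>f\<close>, computing \<open>ip (S f) e\<close> in two ways
  gives \<open>\<mu> * ip f e = l e * ip f e\<close>, so \<open>f\<close> has no component along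
  basis vectors with another eigenvalue.\<close>

lemma eigenspace_eq_span:
  assumes B: "eigenbasis B l"
  shows "eigenspace U S \<mu> = cfun.span {e \<in> B. complex_of_real (l e) = \<mu>}"
proof
  have on: "orthonormal B"
    using B by (simp add: eigenbasis_def)
  show "eigenspace U S \<mu> \<subseteq> cfun.span {e \<in> B. complex_of_real (l e) = \<mu>}"
  proof
    fix f assume "f \<in> eigenspace U S \<mu>"
    then have f: "f \<in> functions_on U" "S f = fscale \<mu> f"
      by (auto simp: eigenspace_def)
    have zero: "ip f e = 0" if "e \<in> B" "complex_of_real (l e) \<noteq> \<mu>" for e
      using ip_S_eigenbasis[OF B f(1) that(1)] that(2) by (simp add: f(2) ip_scale_left)
    have "f = (\<Sum>e\<in>B. fscale (ip f e) e)"
      using orthonormal_expansion[OF on] f(1) B by (simp add: eigenbasis_def)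
    also have "\<dots> = (\<Sum>e\<in>{e \<in> B. complex_of_real (l e) = \<mu>}. fscale (ip f e) e)"
      using orthonormal_card(1)[OF on] zero
      by (intro sum.mono_neutral_right) (auto simp: fun_eq_iff)
    also have "\<dots> \<in> cfun.span {e \<in> B. complex_of_real (l e) = \<mu>}"
      by (intro cfun.span_sum cfun.span_scale cfun.span_base)
    finally show "f \<in> cfun.span {e \<in> B. complex_of_real (l e) = \<mu>}" .
  qed
  have "cfun.subspace (eigenspace U S \<mu>)"
    using subspace_functions_on[of U] cfun_pair.linear_0[OF linear_S]
      cfun_pair.linear_add[OF linear_S] cfun_pair.linear_scale[OF linear_S]
    unfolding cfun.subspace_def eigenspace_def by (auto simp: fun_eq_iff algebra_simps)
  then show "cfun.span {e \<in> B. complex_of_real (l e) = \<mu>} \<subseteq> eigenspace U S \<mu>"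
    using B on by (intro cfun.span_minimal) (auto simp: eigenbasis_def orthonormal_def eigenspace_def)
qed

text \<open>Each dimension prescribed by the definition is the number of basis vectors with that
  eigenvalue. This forces the multiset of entries, and sortedness then leaves exactly one list, so
  the definite description denotes.\<close>

lemma eigenvalue_list_eq:
  assumes B: "eigenbasis B l"
  shows "eigenvalue_list U S = sorted_list_of_multiset (image_mset l (mset_set B))" (is "_ = ?ls")
proof -
  have on: "orthonormal B"
    using B by (simp add: eigenbasis_def)
  note fin = orthonormal_card(1)[OF on]
  have dim: "cfun_dim (eigenspace U S \<mu>) = card {e \<in> B. complex_of_real (l e) = \<mu>}" for \<mu>
    unfolding eigenspace_eq_span[OF B]
    by (intro cfun.dim_span_eq_card_independent orthonormal_independent orthonormal_subset[OF on]) auto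
  have count: "count (image_mset l (mset_set B)) t = card {e \<in> B. l e = t}" for t
    using fin by (auto simp: count_image_mset intro!: arg_cong[of _ _ card])
  show ?thesis
    unfolding eigenvalue_list_def
  proof (rule the_equality)
    show "sorted ?ls \<and> (\<forall>\<mu>. count_list (map complex_of_real ?ls) \<mu> = cfun_dim (eigenspace U S \<mu>))"
    proof (intro conjI allI)
      fix \<mu>
      show "count_list (map complex_of_real ?ls) \<mu> = cfun_dim (eigenspace U S \<mu>)"
        unfolding count_list_of_real dim mset_sorted_list_of_multiset count
        by (auto simp: complex_eq_iff intro!: arg_cong[of _ _ card])
    qed simp
  next
    fix ls
    assume ls: "sorted ls \<and> (\<forall>\<mu>. count_list (map complex_of_real ls) \<mu> = cfun_dim (eigenspace U S \<mu>))"
    have "mset ls = image_mset l (mset_set B)"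
    proof (rule multiset_eqI)
      fix t
      have "count_list (map complex_of_real ls) (of_real t) = card {e \<in> B. l e = t}"
        using ls dim by simp
      then show "count (mset ls) t = count (image_mset l (mset_set B)) t"
        unfolding count_list_of_real count by simp
    qed
    with ls show "ls = ?ls"
      by (metis sorted_list_of_multiset_mset sorted_sort_id)
  qed
qed

text \<open>Turns positions in the list into dimensions of spans of eigenvectors.\<close>

lemma length_filter_eigenvalue_list:
  assumes B: "eigenbasis B l"
  shows "length (filter P (eigenvalue_list U S)) = card {e \<in> B. P (l e)}"
proof -
  have fin: "finite B"
    using B orthonormal_card(1) by (simp add: eigenbasis_def)
  have "length (filter P (eigenvalue_list U S)) = size (filter_mset P (image_mset l (mset_set B)))"
    unfolding eigenvalue_list_eq[OF B] size_mset[symmetric] mset_filter by simp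
  also have "\<dots> = card {e \<in> B. P (l e)}"
    by (simp add: filter_mset_image_mset fin)
  finally show ?thesis .
qed

lemma sorted_eigenvalue_list: "sorted (eigenvalue_list U S)"
proof -
  obtain B l where "eigenbasis B l"
    by (rule obtain_eigenbasis)
  then show ?thesis
    by (simp add: eigenvalue_list_eq)
qed

lemma length_eigenvalue_list: "length (eigenvalue_list U S) = card U"
proof -
  obtain B l where B: "eigenbasis B l"
    by (rule obtain_eigenbasis)
  then show ?thesis
    using length_filter_eigenvalue_list[OF B, of "\<lambda>_. True"] orthonormal_basis_card[of B]
    by (simp add: eigenbasis_def)
qed

section \<open>Rayleigh quotient bounds and min-max comparison\<close>

lemma ip_S_eq_sum:
  assumes B: "eigenbasis B l" and f: "f \<in> functions_on U"
  shows "Re (ip (S f) f) = (\<Sum>e\<in>B. l e * (cmod (ip f e))\<^sup>2)"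
proof -
  have "S f = (\<Sum>e\<in>B. fscale (ip (S f) e) e)"
    using B S_functions_on[OF f] by (intro orthonormal_expansion) (auto simp: eigenbasis_def)
  then have "ip (S f) f = ip (\<Sum>e\<in>B. fscale (ip (S f) e) e) f"
    by simp
  also have "\<dots> = (\<Sum>e\<in>B. ip (S f) e * cnj (ip f e))"
    by (simp add: ip_sum_left ip_scale_left flip: ip_commute)
  also have "\<dots> = (\<Sum>e\<in>B. of_real (l e * (cmod (ip f e))\<^sup>2))"
    by (intro sum.cong refl)
      (simp add: ip_S_eigenbasis[OF B f] mult.assoc flip: complex_norm_square)
  finally show ?thesis
    by simp
qed

text \<open>Coefficients along eigenvectors with eigenvalue above \<open>t\<close> vanish, and in
  the diagonal form the others carry a factor of at most \<open>t\<close>.\<close>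

lemma ip_S_le:
  assumes B: "eigenbasis B l" and f: "f \<in> cfun.span {e \<in> B. l e \<le> t}"
  shows "Re (ip (S f) f) \<le> t * Re (ip f f)"
proof -
  have on: "orthonormal B"
    using B by (simp add: eigenbasis_def)
  have fB: "f \<in> cfun.span B"
    using f cfun.span_mono[of "{e \<in> B. l e \<le> t}" B] by auto
  have "(\<Sum>e\<in>B. l e * (cmod (ip f e))\<^sup>2) \<le> (\<Sum>e\<in>B. t * (cmod (ip f e))\<^sup>2)"
  proof (intro sum_mono)
    fix e assume "e \<in> B"
    then show "l e * (cmod (ip f e))\<^sup>2 \<le> t * (cmod (ip f e))\<^sup>2"
      using ip_span_eq_0[OF on _ f, of e] by (cases "l e \<le> t") (auto intro: mult_right_mono)
  qed
  with fB show ?thesis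
    using B by (simp add: ip_S_eq_sum[OF B] parseval[OF on] sum_distrib_left eigenbasis_def)
qed

text \<open>The counterpart of \<open>ip_S_le\<close>. Orthogonality is assumed instead of
  membership in a span because it is what the kernel argument of the comparison delivers.\<close>

lemma ip_S_ge:
  assumes B: "eigenbasis B l" and f: "f \<in> functions_on U"
    and orth: "\<And>e. e \<in> B \<Longrightarrow> l e < t \<Longrightarrow> ip f e = 0"
  shows "t * Re (ip f f) \<le> Re (ip (S f) f)"
proof -
  have "(\<Sum>e\<in>B. t * (cmod (ip f e))\<^sup>2) \<le> (\<Sum>e\<in>B. l e * (cmod (ip f e))\<^sup>2)"
  proof (intro sum_mono)
    fix e assume "e \<in> B"
    then show "t * (cmod (ip f e))\<^sup>2 \<le> l e * (cmod (ip f e))\<^sup>2"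
      using orth[of e] by (cases "l e < t") (auto intro: mult_right_mono)
  qed
  with f B show ?thesis
    by (simp add: ip_S_eq_sum[OF B] parseval[of B] sum_distrib_left eigenbasis_def)
qed

end

text \<open>Let \<open>s\<close> and \<open>t\<close> be the entries of \<open>S\<close> and
  \<open>S'\<close> at position \<open>k\<close>, and suppose \<open>s < t\<close>. More than
  \<open>k\<close> basis eigenvectors of \<open>S\<close> have eigenvalue \<le> \<open>s\<close>,
  and at most \<open>k\<close> of \<open>S'\<close> lie below \<open>t\<close>, so some nonzero
  \<open>f\<close> in the span of the former has \<open>T f\<close> orthogonal to the latter. Then
  \<open>t\<close> times the squared norm of \<open>f\<close> is at most \<open>t\<close> times that
  of \<open>T f\<close>, hence at most the form of \<open>S'\<close> at \<open>T f\<close>, hence at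
  most the form of \<open>S\<close> at \<open>f\<close>, hence at most \<open>s\<close> times the
  squared norm of \<open>f\<close>.\<close>

lemma eigenvalue_list_mono:
  fixes S :: "('a \<Rightarrow> complex) \<Rightarrow> 'a \<Rightarrow> complex" and S' :: "('b \<Rightarrow> complex) \<Rightarrow> 'b \<Rightarrow> complex"
  assumes "symmetric_operator U m S" "symmetric_operator U' m' S'"
    and T: "Vector_Spaces.linear fscale fscale T"
    and T_functions_on: "\<And>f. f \<in> functions_on U \<Longrightarrow> T f \<in> functions_on U'"
    and T_norm: "\<And>f. f \<in> functions_on U \<Longrightarrow>
      Re (weighted_vertex_set.ip U m f f) \<le> Re (weighted_vertex_set.ip U' m' (T f) (T f))"
    and T_form: "\<And>f. f \<in> functions_on U \<Longrightarrow>
      Re (weighted_vertex_set.ip U' m' (S' (T f)) (T f)) \<le> Re (weighted_vertex_set.ip U m (S f) f)"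
    and S_nonneg: "\<And>f. f \<in> functions_on U \<Longrightarrow> 0 \<le> Re (weighted_vertex_set.ip U m (S f) f)"
    and k: "k < card U" "k < card U'"
  shows "eigenvalue_list U' S' ! k \<le> eigenvalue_list U S ! k"
proof (rule ccontr)
  interpret A: symmetric_operator U m S by fact
  interpret B: symmetric_operator U' m' S' by fact
  define s where "s = eigenvalue_list U S ! k"
  define t where "t = eigenvalue_list U' S' ! k"
  assume "\<not> eigenvalue_list U' S' ! k \<le> eigenvalue_list U S ! k"
  then have "s < t"
    by (simp add: s_def t_def)
  obtain D d where D: "A.eigenbasis D d"
    by (rule A.obtain_eigenbasis)
  obtain E l where E: "B.eigenbasis E l"
    by (rule B.obtain_eigenbasis)
  note onE = E[unfolded B.eigenbasis_def, THEN conjunct1]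
  note onD = D[unfolded A.eigenbasis_def, THEN conjunct1]
  define C where "C = {e \<in> E. l e < t}"
  have C: "C \<subseteq> E" "finite C"
    using B.orthonormal_card(1)[OF onE] by (auto simp: C_def)
  have "card C \<le> k"
    using sorted_filter_less_nth[OF B.sorted_eigenvalue_list] k
    unfolding C_def t_def B.length_filter_eigenvalue_list[OF E, of "\<lambda>x. x < t", symmetric, unfolded t_def]
    by (simp add: B.length_eigenvalue_list)
  moreover have "k < card {e \<in> D. d e \<le> s}"
    using sorted_filter_le_nth[OF A.sorted_eigenvalue_list] k
    unfolding s_def A.length_filter_eigenvalue_list[OF D, of "\<lambda>x. x \<le> s", symmetric, unfolded s_def]
    by (simp add: A.length_eigenvalue_list)
  ultimately have card: "card C < card {e \<in> D. d e \<le> s}"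
    by simp
  \<comment> \<open>\<open>R f\<close> is the projection of \<open>T f\<close> onto the span of
    \<open>C\<close>; its kernel consists of the \<open>f\<close> for which \<open>T f\<close> is
    orthogonal to \<open>C\<close>.\<close>
  define R where "R f = (\<Sum>c\<in>C. fscale (B.ip (T f) c) c)" for f
  have "Vector_Spaces.linear fscale fscale R"
  proof (intro cfun_linearI ext)
    show "R (f + g) x = (R f + R g) x" for f g x
      unfolding R_def plus_fun_apply sum_fun_apply cfun_pair.linear_add[OF T] B.ip_add_left
        distrib_right sum.distrib ..
    show "R (fscale c f) x = c * R f x" for c f x
      unfolding R_def sum_fun_apply cfun_pair.linear_scale[OF T] B.ip_scale_left
        mult.assoc sum_distrib_left ..
  qed
  moreover have "cfun.independent {e \<in> D. d e \<le> s}"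
    by (intro A.orthonormal_independent A.orthonormal_subset[OF onD]) auto
  moreover have "R f \<in> cfun.span C" for f
    unfolding R_def by (intro cfun.span_sum cfun.span_scale cfun.span_base)
  ultimately obtain f where f: "f \<in> cfun.span {e \<in> D. d e \<le> s}" "f \<noteq> 0" "R f = 0"
    using cfun_linear_kernel[OF _ _ C(2) card] by blast
  have "f \<in> functions_on U"
    using f(1) D cfun.span_mono[of "{e \<in> D. d e \<le> s}" D] by (auto simp: A.eigenbasis_def)
  have "B.ip (T f) e = 0" if "e \<in> E" "l e < t" for e
  proof -
    have "B.ip (R f) e = B.ip (T f) e"
      unfolding R_def using that C by (subst B.ip_orthonormal_sum[OF onE]) (auto simp: C_def)
    with f(3) show ?thesis
      by simp
  qed
  then have ge: "t * Re (B.ip (T f) (T f)) \<le> Re (B.ip (S' (T f)) (T f))"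
    using B.ip_S_ge[OF E T_functions_on[OF \<open>f \<in> functions_on U\<close>]] by blast
  have le: "Re (A.ip (S f) f) \<le> s * Re (A.ip f f)"
    by (rule A.ip_S_le[OF D f(1)])
  have pos: "0 < Re (A.ip f f)"
    by (rule A.ip_self_pos[OF \<open>f \<in> functions_on U\<close> f(2)])
  \<comment> \<open>Nonnegativity of the form enters here: it makes \<open>t\<close> positive, so
    multiplying the norm inequality by \<open>t\<close> keeps its direction.\<close>
  have "0 \<le> s"
    using S_nonneg[OF \<open>f \<in> functions_on U\<close>] le pos by (smt (verit) mult_neg_pos)
  then have "t * Re (A.ip f f) \<le> t * Re (B.ip (T f) (T f))"
    using T_norm[OF \<open>f \<in> functions_on U\<close>] \<open>s < t\<close> by (intro mult_left_mono) auto
  also have "\<dots> \<le> s * Re (A.ip f f)"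
    using ge le T_form[OF \<open>f \<in> functions_on U\<close>] by linarith
  finally show False
    using \<open>s < t\<close> pos by simp
qed

section \<open>Laplacians of symmetric weights and the Dirichlet form\<close>

locale symmetric_weighted_graph = weighted_vertex_set +
  fixes a :: "'a \<Rightarrow> 'a \<Rightarrow> real"
  assumes a_nonneg: "x \<in> U \<Longrightarrow> y \<in> U \<Longrightarrow> 0 \<le> a x y"
    and a_commute: "x \<in> U \<Longrightarrow> y \<in> U \<Longrightarrow> a x y = a y x"
begin

text \<open>The sum runs over all of \<open>U\<close>, with absent edges represented by weight 0.
  The value 0 off \<open>U\<close> puts the result in \<open>functions_on U\<close>.\<close>

definition laplacian :: "('a \<Rightarrow> complex) \<Rightarrow> 'a \<Rightarrow> complex" where
  "laplacian f x =
     (if x \<in> U then 1 / of_real (m x) * (\<Sum>y\<in>U. of_real (a x y) * (f x - f y)) else 0)"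

text \<open>Discrete Green formula. Exchanging \<open>x\<close> and \<open>y\<close> and using the
  symmetry of \<open>a\<close> gives a second expression for the inner product, with
  \<open>- cnj (g y)\<close> in place of \<open>cnj (g x)\<close>; the formula is the average of the
  two.\<close>

lemma ip_laplacian:
  "ip (laplacian f) g =
     (\<Sum>x\<in>U. \<Sum>y\<in>U. of_real (a x y) * (f x - f y) * cnj (g x - g y)) / 2"
proof -
  have 1: "ip (laplacian f) g = (\<Sum>x\<in>U. \<Sum>y\<in>U. of_real (a x y) * (f x - f y) * cnj (g x))"
    unfolding ip_def
  proof (intro sum.cong refl)
    fix x assume "x \<in> U"
    then have "complex_of_real (m x) \<noteq> 0"
      using m_pos by fastforce
    with \<open>x \<in> U\<close> show "of_real (m x) * laplacian f x * cnj (g x) =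
        (\<Sum>y\<in>U. of_real (a x y) * (f x - f y) * cnj (g x))"
      by (simp add: laplacian_def sum_distrib_right)
  qed
  also have "\<dots> = (\<Sum>y\<in>U. \<Sum>x\<in>U. of_real (a x y) * (f x - f y) * cnj (g x))"
    by (rule sum.swap)
  also have "\<dots> = - (\<Sum>x\<in>U. \<Sum>y\<in>U. of_real (a x y) * (f x - f y) * cnj (g y))"
    unfolding sum_negf[symmetric] by (intro sum.cong refl) (simp add: a_commute algebra_simps)
  finally have 2: "ip (laplacian f) g = \<dots>" .
  have "2 * ip (laplacian f) g = (\<Sum>x\<in>U. \<Sum>y\<in>U. of_real (a x y) * (f x - f y) * cnj (g x))
      + - (\<Sum>x\<in>U. \<Sum>y\<in>U. of_real (a x y) * (f x - f y) * cnj (g y))"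
    using 1 2 by simp
  also have "\<dots> = (\<Sum>x\<in>U. \<Sum>y\<in>U. of_real (a x y) * (f x - f y) * cnj (g x - g y))"
    by (simp add: right_diff_distrib sum_subtractf)
  finally show ?thesis
    by (simp add: mult.commute del: complex_cnj_diff)
qed

lemma Re_ip_laplacian:
  "Re (ip (laplacian f) f) = (\<Sum>x\<in>U. \<Sum>y\<in>U. a x y * (cmod (f x - f y))\<^sup>2) / 2"
proof -
  have "ip (laplacian f) f = of_real ((\<Sum>x\<in>U. \<Sum>y\<in>U. a x y * (cmod (f x - f y))\<^sup>2) / 2)"
    unfolding ip_laplacian by (simp add: mult.assoc del: complex_cnj_diff flip: complex_norm_square)
  then show ?thesis
    by (simp only: Re_complex_of_real)
qed

lemma Re_ip_laplacian_nonneg: "0 \<le> Re (ip (laplacian f) f)"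
  unfolding Re_ip_laplacian by (intro divide_nonneg_pos sum_nonneg mult_nonneg_nonneg a_nonneg) auto

sublocale symmetric_operator U m laplacian
proof
  show "laplacian (f + g) = laplacian f + laplacian g" for f g
    by (auto simp: laplacian_def fun_eq_iff sum.distrib distrib_left right_diff_distrib
        sum_subtractf add_divide_distrib diff_divide_distrib)
  show "laplacian (fscale c f) = fscale c (laplacian f)" for c f
    by (auto simp: laplacian_def fun_eq_iff sum_distrib_left algebra_simps)
  show "laplacian f \<in> functions_on U" for f
    by (simp add: laplacian_def functions_on_def)
  \<comment> \<open>Exchanging \<open>f\<close> and \<open>g\<close> in the Green formula conjugates
    it, since \<open>a\<close> is real.\<close>
  show "ip (laplacian f) g = ip f (laplacian g)" for f g
    by (subst (2) ip_commute) (simp add: ip_laplacian mult_ac)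
qed

end

section \<open>Collapsing the petals\<close>

lemma sum_retraction:
  fixes a :: "'a \<Rightarrow> 'a \<Rightarrow> real" and f :: "'a \<Rightarrow> complex"
  assumes "finite V" "W \<subseteq> V" "\<And>x. x \<in> W \<Longrightarrow> \<phi> x = x"
    and "\<And>x y. x \<in> V \<Longrightarrow> y \<in> V \<Longrightarrow> a x y \<noteq> 0 \<Longrightarrow> x \<in> W \<and> y \<in> W \<or> \<phi> x = \<phi> y"
  shows "(\<Sum>x\<in>V. \<Sum>y\<in>V. a x y * (cmod (f (\<phi> x) - f (\<phi> y)))\<^sup>2) =
         (\<Sum>x\<in>W. \<Sum>y\<in>W. a x y * (cmod (f x - f y))\<^sup>2)"
  unfolding sum.cartesian_product
proof (intro sum.mono_neutral_cong_right ballI)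
  \<comment> \<open>Off \<open>W \<times> W\<close> a pair has weight 0 or both its ends have the
    same image, so its term vanishes.\<close>
  fix z assume "z \<in> V \<times> V - W \<times> W"
  then show "(case z of (x, y) \<Rightarrow> a x y * (cmod (f (\<phi> x) - f (\<phi> y)))\<^sup>2) = 0"
    using assms(4)[of "fst z" "snd z"] by (cases "a (fst z) (snd z) = 0") (auto simp: case_prod_beta)
qed (use assms(1-3) in auto)

text \<open>A vertex outside \<open>H\<close> is interior to a petal, so its neighbours belong to
  that petal. A neighbour in \<open>H\<close> must be the vertex the petal shares with
  \<open>H\<close>; a neighbour outside \<open>H\<close> is interior to some petal, and by the
  separation condition to the same one. In both cases the two images agree.\<close>

lemma flower_retraction:
  fixes G H :: "'a pair_pre_digraph"
  assumes "flower_like TYPE('i) H G"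
  obtains \<phi> where "\<And>x. x \<in> pverts G \<Longrightarrow> \<phi> x \<in> pverts H" "\<And>x. x \<in> pverts H \<Longrightarrow> \<phi> x = x"
    "\<And>x y. x \<in> pverts G \<Longrightarrow> y \<in> pverts G \<Longrightarrow> y \<in> nbrs G x \<Longrightarrow>
       x \<in> pverts H \<and> y \<in> pverts H \<or> \<phi> x = \<phi> y"
proof -
  obtain I :: "'i set" and K :: "'i \<Rightarrow> 'a pair_pre_digraph" where
    cover: "pverts G = pverts H \<union> (\<Union>i\<in>I. vertex_interior G (pverts (K i)))"
    and sep: "\<forall>i\<in>I. \<forall>j\<in>I. i \<noteq> j \<longrightarrow> (\<forall>x\<in>vertex_interior G (pverts (K i)).
        \<forall>y\<in>vertex_interior G (pverts (K j)). x \<notin> nbrs G y)"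
    and base: "\<forall>i\<in>I. \<exists>v\<in>pverts G. pverts H \<inter> pverts (K i) = {v}"
    using assms unfolding flower_like_def by (elim exE conjE) (rule that, assumption+)
  obtain c where c: "\<And>i. i \<in> I \<Longrightarrow> pverts H \<inter> pverts (K i) = {c i}"
    using base by metis
  have "\<forall>x\<in>pverts G - pverts H. \<exists>i. i \<in> I \<and> x \<in> vertex_interior G (pverts (K i))"
    using cover by blast
  then obtain p where p: "\<And>x. x \<in> pverts G \<Longrightarrow> x \<notin> pverts H \<Longrightarrow>
      p x \<in> I \<and> x \<in> vertex_interior G (pverts (K (p x)))"
    by (metis DiffI)
  \<comment> \<open>Vertices of \<open>H\<close> stay fixed even if they are interior to a petal;
    the choice \<open>p\<close> is consulted outside \<open>H\<close> only.\<close>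
  define \<phi> where "\<phi> x = (if x \<in> pverts H then x else c (p x))" for x
  have nbrs_commute: "y \<in> nbrs G x \<longleftrightarrow> x \<in> nbrs G y" for x y
    by (auto simp: nbrs_def out_nbrs_def in_nbrs_def)
  have petal: "\<phi> x = \<phi> y"
    if "x \<in> pverts G" "x \<notin> pverts H" "y \<in> pverts G" "y \<in> nbrs G x" for x y
  proof (cases "y \<in> pverts H")
    case True
    then have "y \<in> pverts H \<inter> pverts (K (p x))"
      using p[OF that(1,2)] that(4) by (auto simp: vertex_interior_def)
    with True that c[of "p x"] p[OF that(1,2)] show ?thesis
      by (auto simp: \<phi>_def)
  next
    case False
    with p that have "p y \<in> I" "y \<in> vertex_interior G (pverts (K (p y)))"
      "p x \<in> I" "x \<in> vertex_interior G (pverts (K (p x)))"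
      by auto
    then have "p x = p y"
      using sep[rule_format, of "p y" "p x" y x] that(4) by metis
    with False that show ?thesis
      by (simp add: \<phi>_def)
  qed
  show thesis
  proof (rule that[of \<phi>])
    show "\<phi> x \<in> pverts H" if "x \<in> pverts G" for x
      using c[of "p x"] p[OF that] by (auto simp: \<phi>_def)
    show "\<phi> x = x" if "x \<in> pverts H" for x
      using that by (simp add: \<phi>_def)
    show "x \<in> pverts H \<and> y \<in> pverts H \<or> \<phi> x = \<phi> y"
      if "x \<in> pverts G" "y \<in> pverts G" "y \<in> nbrs G x" for x y
      using petal[OF that(1) _ that(2,3)]
        petal[OF that(2) _ that(1) that(3)[unfolded nbrs_commute[of y x]], symmetric] by blast
  qed
qed

text \<open>Neighbours of a vertex of \<open>U\<close> lie in \<open>U\<close>, and all other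
  vertices of \<open>U\<close> carry weight 0, so the sum may be extended to \<open>U\<close>. Off
  \<open>U\<close> the sum over neighbours is empty.\<close>

lemma (in symmetric_weighted_graph) special_laplacian_eq_laplacian:
  assumes "pverts K = U" "parcs K \<subseteq> U \<times> U"
    and a: "\<And>x y. x \<in> U \<Longrightarrow> y \<in> U \<Longrightarrow> a x y = b x y + b y x"
    and "\<And>x y. x \<in> U \<Longrightarrow> y \<in> U \<Longrightarrow> y \<notin> nbrs K x \<Longrightarrow> a x y = 0"
  shows "special_laplacian K b m = laplacian"
proof (intro ext)
  fix f x
  show "special_laplacian K b m f x = laplacian f x"
  proof (cases "x \<in> U")
    case True
    have sub: "nbrs K x \<subseteq> U"
      using assms(2) by (auto simp: nbrs_def out_nbrs_def in_nbrs_def)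
    have "(\<Sum>y\<in>nbrs K x. of_real (b x y + b y x) * (f x - f y)) =
        (\<Sum>y\<in>U. complex_of_real (a x y) * (f x - f y))"
      using True sub assms(4) finite_U by (intro sum.mono_neutral_cong_left) (auto simp: a subset_iff)
    with True show ?thesis
      by (simp add: special_laplacian_def laplacian_def)
  next
    case False
    then have "nbrs K x = {}"
      using assms(2) by (auto simp: nbrs_def out_nbrs_def in_nbrs_def)
    with False show ?thesis
      by (simp add: special_laplacian_def laplacian_def)
  qed
qed

section \<open>Eigenvalue comparison by pulling functions back along the retraction\<close>

theorem theorem3p2:
  fixes G H :: "'a pair_pre_digraph"
    and b :: "'a \<Rightarrow> 'a \<Rightarrow> real" and m :: "'a \<Rightarrow> real"
    and r k :: nat
  assumes "balanced_weighted_digraph G b m"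
    and "induced_subgraph (with_proj H) (with_proj G)"
    and "card (pverts H) = r"
    and "flower_like TYPE('i) H G"
    and "1 \<le> k" and "k \<le> r"
  shows "eigenvalue_nr k H b m \<ge> eigenvalue_nr k G b m"
proof -
  interpret G: balanced_weighted_digraph G b m by fact
  let ?V = "pverts G" and ?W = "pverts H"
  have sub: "?W \<subseteq> ?V"
    using assms(2) by (auto simp: induced_subgraph_def subgraph_def)
  have arcs_G: "parcs G \<subseteq> ?V \<times> ?V"
    using G.in_arcsD1 G.in_arcsD2 by auto
  have arcs_H: "parcs H \<subseteq> ?W \<times> ?W"
    using assms(2) by (auto simp: induced_subgraph_def)
  have "finite ?V"
    by (rule G.pair_finite_verts)
  define a where "a x y = b x y + b y x" for x y
  \<comment> \<open>With nonnegative weights, a nonzero sum has a positive summand, that is, an arc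
    in one of the two directions.\<close>
  have nbr: "y \<in> nbrs G x" if "x \<in> ?V" "y \<in> ?V" "a x y \<noteq> 0" for x y
    using that G.b_nonneg[of x y] G.b_nonneg[of y x] G.b_pos_iff[of x y] G.b_pos_iff[of y x]
    by (auto simp: a_def nbrs_def out_nbrs_def in_nbrs_def less_le)
  interpret g: symmetric_weighted_graph ?V m a
    by standard (auto simp: a_def \<open>finite ?V\<close> G.m_pos G.b_nonneg)
  interpret h: symmetric_weighted_graph ?W m a
    using sub finite_subset[OF sub \<open>finite ?V\<close>]
    by unfold_locales (auto simp: subset_iff g.m_pos g.a_nonneg g.a_commute)
  have lap_G: "special_laplacian G b m = g.laplacian"
    using nbr by (intro g.special_laplacian_eq_laplacian arcs_G) (auto simp: a_def)
  \<comment> \<open>As \<open>H\<close> is induced, vertices of \<open>H\<close> that are neighbours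
    in \<open>G\<close> are neighbours in \<open>H\<close>, so the same \<open>a\<close> serves both
    graphs.\<close>
  have lap_H: "special_laplacian H b m = h.laplacian"
    using nbr sub nbrs_induced_subgraph[OF assms(2)]
    by (intro h.special_laplacian_eq_laplacian arcs_H) (auto simp: a_def)
  obtain \<phi> where \<phi>: "\<And>x. x \<in> ?V \<Longrightarrow> \<phi> x \<in> ?W" "\<And>x. x \<in> ?W \<Longrightarrow> \<phi> x = x"
    "\<And>x y. x \<in> ?V \<Longrightarrow> y \<in> ?V \<Longrightarrow> y \<in> nbrs G x \<Longrightarrow> x \<in> ?W \<and> y \<in> ?W \<or> \<phi> x = \<phi> y"
    using flower_retraction[OF assms(4)] by blast
  define T :: "('a \<Rightarrow> complex) \<Rightarrow> 'a \<Rightarrow> complex"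
    where "T f x = (if x \<in> ?V then f (\<phi> x) else 0)" for f x
  have T_linear: "Vector_Spaces.linear fscale fscale T"
    by (rule cfun_linearI) (auto simp: T_def fun_eq_iff)
  \<comment> \<open>\<open>T f\<close> extends \<open>f\<close> from \<open>?W\<close>, and the
    further vertices add nonnegative terms.\<close>
  have T_norm: "Re (h.ip f f) \<le> Re (g.ip (T f) (T f))" for f
  proof -
    have "Re (h.ip f f) = (\<Sum>x\<in>?W. m x * (cmod (T f x))\<^sup>2)"
      unfolding h.ip_self Re_complex_of_real using sub \<phi>(2)
      by (intro sum.cong) (auto simp: T_def)
    also have "\<dots> \<le> (\<Sum>x\<in>?V. m x * (cmod (T f x))\<^sup>2)"
      using sub \<open>finite ?V\<close> g.m_pos by (intro sum_mono2) (auto simp: less_imp_le)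
    finally show ?thesis
      by (simp add: g.ip_self)
  qed
  have T_form: "Re (g.ip (g.laplacian (T f)) (T f)) = Re (h.ip (h.laplacian f) f)" for f
  proof -
    have "(\<Sum>x\<in>?V. \<Sum>y\<in>?V. a x y * (cmod (T f x - T f y))\<^sup>2) =
        (\<Sum>x\<in>?V. \<Sum>y\<in>?V. a x y * (cmod (f (\<phi> x) - f (\<phi> y)))\<^sup>2)"
      by (intro sum.cong) (auto simp: T_def)
    also have "\<dots> = (\<Sum>x\<in>?W. \<Sum>y\<in>?W. a x y * (cmod (f x - f y))\<^sup>2)"
      using \<open>finite ?V\<close> sub \<phi>(2) \<phi>(3) nbr by (intro sum_retraction) blast+
    finally show ?thesis
      by (simp add: g.Re_ip_laplacian h.Re_ip_laplacian)
  qed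
  \<comment> \<open>Eigenvalues are numbered from 1, list positions from 0.\<close>
  have "k - 1 < card ?W"
    using assms(3,5,6) by simp
  moreover have "card ?W \<le> card ?V"
    using sub \<open>finite ?V\<close> by (rule card_mono[rotated])
  moreover have "symmetric_operator ?V m g.laplacian" "symmetric_operator ?W m h.laplacian"
    by unfold_locales
  ultimately have "eigenvalue_list ?V g.laplacian ! (k - 1) \<le> eigenvalue_list ?W h.laplacian ! (k - 1)"
    using T_linear T_norm T_form h.Re_ip_laplacian_nonneg
    by (intro eigenvalue_list_mono[where T = T])
      (auto simp: T_def functions_on_def)
  then show ?thesis
    by (simp add: eigenvalue_nr_def lap_G lap_H)
qed

end
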